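(* Let $Q$ be a smooth $d$-dimensional manifold, let $m,k>0$, and let $H:T^*Q\to\mathbb{R}$, $G_1,\dots,G_m:T^*Q\to\mathbb{R}$ and $\phi_1,\dots,\phi_k:T^*Q\to\mathbb{R}$ be smooth functions (Hamiltonian, outputs $y_j=G_j(x)$, and constraints $\phi_i(x)=0$). Define $H_T:T^*Q\times\mathbb{R}^m\times\mathbb{R}^k\to\mathbb{R}$ by $$H_T(x,u,\lambda)=H(x)+\sum_{j=1}^m u^jG_j(x)+\sum_{i=1}^k\lambda^i\phi_i(x).$$ Suppose that 1. $0\in\mathbb{R}^k$ is a regular value of $(\phi_1,\dots,\phi_k):T^*Q\to\mathbb{R}^k$, i.e. at every $x\in T^*Q$ with $\phi_1(x)=\dots=\phi_k(x)=0$ the matrix with rows $\frac{\partial\phi_1}{\partial x}(x),\dots,\frac{\partial\phi_k}{\partial x}(x)$ has rank $k$; and 2. there is no redundancy in the inputs, i.e. at every $x\in T^*Q$ the matrix with rows $\frac{\partial G_1}{\partial x}(x),\dots,\frac{\partial G_m}{\partial x}(x)$ has rank $m$. Then $H_T$ is a restricted Morse family on $T^*Q\times\mathbb{R}^m$ with parameters $\lambda\in\mathbb{R}^k$.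
   Context: Let $\mathcal{X}$ be a smooth $n$-dimensional manifold (here $\mathcal{X}=T^*Q$, $n=2d$) with local coordinates $x=(x^1,\dots,x^n)$, and let $\nu=(\nu^1,\dots,\nu^m)$ be coordinates on $\mathbb{R}^m$ (here $\nu=u$, the inputs). For a smooth function $K:\mathcal{X}\times\mathbb{R}^m\times\mathbb{R}^k\to\mathbb{R}$, $k>0$, regarded as a family of functions on $\mathcal{X}\times\mathbb{R}^m$ with parameters $\lambda\in\mathbb{R}^k$, the critical set is $$\Sigma_K=\Big\{(x,\nu,\lambda)\ \Big|\ \frac{\partial K}{\partial\lambda^i}(x,\nu,\lambda)=0,\ i=1,\dots,k\Big\}.$$ $K$ is called a Morse family on $\mathcal{X}\times\mathbb{R}^m$ if the $k\times(n+m+k)$ matrix $$\begin{pmatrix}\frac{\partial^2K}{\partial\lambda^i\partial x^j}&\frac{\partial^2K}{\partial\lambda^i\partial\nu^j}&\frac{\partial^2K}{\partial\lambda^i\partial\lambda^j}\end{pmatrix}$$ has rank $k$ at every point of $\Sigma_K$. A Morse family $K$ on $\mathcal{X}\times\mathbb{R}^m$ is called a restricted Morse family if in addition the $m\times(n+m)$ matrix $$\begin{pmatrix}\frac{\partial^2K}{\partial\nu^i\partial x^j}&\frac{\partial^2K}{\partial\nu^i\partial\nu^j}\end{pmatrix}$$ has rank $m$ at every point of $\Sigma_K$. *)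

theory Defs
  imports "HOL-Analysis.Analysis"
begin

section \<open>Smooth functions on open subsets of normed vector spaces\<close>

text \<open>The notions below are meant for open \<open>S\<close>; over a finite-dimensional domain, \<open>Ck_on n S f\<close>
  is then the usual \<open>C\<^sup>n\<close> condition.\<close>

primrec Ck_on :: "nat \<Rightarrow> 'a::real_normed_vector set \<Rightarrow> ('a \<Rightarrow> 'b::real_normed_vector) \<Rightarrow> bool" where
  "Ck_on 0 S f \<longleftrightarrow> continuous_on S f"
| "Ck_on (Suc n) S f \<longleftrightarrow>
     (\<forall>x\<in>S. f differentiable (at x)) \<and> (\<forall>v. Ck_on n S (\<lambda>x. frechet_derivative f (at x) v))"

definition smooth_on :: "'a::real_normed_vector set \<Rightarrow> ('a \<Rightarrow> 'b::real_normed_vector) \<Rightarrow> bool" where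
  "smooth_on S f \<longleftrightarrow> (\<forall>n. Ck_on n S f)"

definition partial_deriv :: "'n::finite \<Rightarrow> (real^'n \<Rightarrow> real) \<Rightarrow> real^'n \<Rightarrow> real" where
  "partial_deriv j f x = deriv (\<lambda>t. f (x + t *\<^sub>R axis j 1)) 0"


section \<open>Smooth manifolds\<close>

text \<open>A chart is its domain together with its coordinate map; values of the map outside the domain
  are irrelevant. Its inverse is \<open>inv_into U \<psi>\<close>.\<close>

type_synonym ('a, 'n) chart = "'a set \<times> ('a \<Rightarrow> real^'n)"

definition smooth_manifold :: "'a topology \<Rightarrow> ('a, 'n::finite) chart set \<Rightarrow> bool" where
  "smooth_manifold X A \<longleftrightarrow>
     Hausdorff_space X \<and> second_countable X \<and>
     (\<Union>(U, \<psi>)\<in>A. U) = topspace X \<and>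
     (\<forall>(U, \<psi>)\<in>A. openin X U \<and> open (\<psi> ` U) \<and>
        homeomorphic_map (subtopology X U) (top_of_set (\<psi> ` U)) \<psi>) \<and>
     (\<forall>(U, \<psi>)\<in>A. \<forall>(V, \<eta>)\<in>A. smooth_on (\<psi> ` (U \<inter> V)) (\<lambda>y. \<eta> (inv_into U \<psi> y)))"

definition smooth_fun_on :: "('a, 'n::finite) chart set \<Rightarrow> 'a set \<Rightarrow> ('a \<Rightarrow> real) \<Rightarrow> bool" where
  "smooth_fun_on A W f \<longleftrightarrow>
     (\<forall>(U, \<psi>)\<in>A. smooth_on (\<psi> ` (U \<inter> W)) (\<lambda>y. f (inv_into U \<psi> y)))"

definition smooth_near :: "'a topology \<Rightarrow> ('a, 'n::finite) chart set \<Rightarrow> 'a \<Rightarrow> ('a \<Rightarrow> real) \<Rightarrow> bool" where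
  "smooth_near X A q f \<longleftrightarrow> (\<exists>W. openin X W \<and> q \<in> W \<and> smooth_fun_on A W f)"

text \<open>\<open>chart_partial (U, \<psi>) j f q\<close> is the partial derivative of \<open>f\<close> at \<open>q\<close> with respect to the
  \<open>j\<close>-th local coordinate of the chart.\<close>

fun chart_partial :: "('a, 'n::finite) chart \<Rightarrow> 'n \<Rightarrow> ('a \<Rightarrow> real) \<Rightarrow> 'a \<Rightarrow> real" where
  "chart_partial (U, \<psi>) j f q = partial_deriv j (\<lambda>y. f (inv_into U \<psi> y)) (\<psi> q)"


section \<open>The cotangent bundle\<close>

text \<open>Tangent vectors at \<open>q\<close> are derivations of the algebra of functions that are smooth near \<open>q\<close>;
  such a derivation depends only on the germ of its argument (apply the product rule to \<open>f = f \<cdot> g\<close>,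
  where \<open>f\<close> vanishes near \<open>q\<close> and \<open>g\<close> is \<open>0\<close> there and \<open>1\<close> elsewhere). Derivations and covectors are
  normalised to be \<open>0\<close> outside their domain, so that each has a unique representative.\<close>

definition tangent_space ::
    "'q topology \<Rightarrow> ('q, 'd::finite) chart set \<Rightarrow> 'q \<Rightarrow> (('q \<Rightarrow> real) \<Rightarrow> real) set" where
  "tangent_space X A q =
     {v. (\<forall>f g. smooth_near X A q f \<longrightarrow> smooth_near X A q g \<longrightarrow>
            v (\<lambda>y. f y + g y) = v f + v g \<and>
            v (\<lambda>y. f y * g y) = f q * v g + g q * v f) \<and>
         (\<forall>c f. smooth_near X A q f \<longrightarrow> v (\<lambda>y. c * f y) = c * v f) \<and>
         (\<forall>f. \<not> smooth_near X A q f \<longrightarrow> v f = 0)}"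

definition cotangent_space ::
    "'q topology \<Rightarrow> ('q, 'd::finite) chart set \<Rightarrow> 'q \<Rightarrow> ((('q \<Rightarrow> real) \<Rightarrow> real) \<Rightarrow> real) set" where
  "cotangent_space X A q =
     {\<alpha>. (\<forall>v\<in>tangent_space X A q. \<forall>w\<in>tangent_space X A q. \<alpha> (\<lambda>f. v f + w f) = \<alpha> v + \<alpha> w) \<and>
         (\<forall>c. \<forall>v\<in>tangent_space X A q. \<alpha> (\<lambda>f. c * v f) = c * \<alpha> v) \<and>
         (\<forall>v. v \<notin> tangent_space X A q \<longrightarrow> \<alpha> v = 0)}"

type_synonym 'q covec = "'q \<times> ((('q \<Rightarrow> real) \<Rightarrow> real) \<Rightarrow> real)"

definition cotangent_bundle :: "'q topology \<Rightarrow> ('q, 'd::finite) chart set \<Rightarrow> 'q covec set" where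
  "cotangent_bundle X A = (SIGMA q : topspace X. cotangent_space X A q)"

definition coord_vector ::
    "'q topology \<Rightarrow> ('q, 'd::finite) chart set \<Rightarrow> ('q, 'd) chart \<Rightarrow> 'q \<Rightarrow> 'd \<Rightarrow> ('q \<Rightarrow> real) \<Rightarrow> real" where
  "coord_vector X A c q i = (\<lambda>f. if smooth_near X A q f then chart_partial c i f q else 0)"

text \<open>The natural chart of the cotangent bundle over a chart of the base: the coordinates of
  \<open>(q, \<alpha>)\<close> are the coordinates of \<open>q\<close> (indices \<open>Inl i\<close>) followed by the components
  \<open>p\<^sub>i = \<alpha> (\<partial>/\<partial>q\<^sup>i)\<close> (indices \<open>Inr i\<close>).\<close>

definition cotangent_chart ::
    "'q topology \<Rightarrow> ('q, 'd::finite) chart set \<Rightarrow> ('q, 'd) chart \<Rightarrow> ('q covec, 'd + 'd) chart" where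
  "cotangent_chart X A c =
     ({z \<in> cotangent_bundle X A. fst z \<in> fst c},
      \<lambda>(q, \<alpha>). \<chi> s. case s of Inl i \<Rightarrow> snd c q $ i | Inr i \<Rightarrow> \<alpha> (coord_vector X A c q i))"

definition cotangent_atlas ::
    "'q topology \<Rightarrow> ('q, 'd::finite) chart set \<Rightarrow> ('q covec, 'd + 'd) chart set" where
  "cotangent_atlas X A = cotangent_chart X A ` A"


section \<open>Morse families\<close>

text \<open>A family is a function \<open>K\<close> of \<open>(x, \<nu>, \<mu>)\<close>, where \<open>x\<close> ranges over a manifold with underlying
  set \<open>M\<close> and atlas \<open>A\<close>, and \<open>\<mu>\<close> is the parameter usually written \<open>\<lambda>\<close>.\<close>

definition smooth_family ::
    "('a, 'n::finite) chart set \<Rightarrow> ('a \<times> (real^'m) \<times> (real^'k) \<Rightarrow> real) \<Rightarrow> bool" where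
  "smooth_family A K \<longleftrightarrow>
     (\<forall>(U, \<psi>)\<in>A. smooth_on (\<psi> ` U \<times> UNIV) (\<lambda>(y, \<nu>, \<mu>). K (inv_into U \<psi> y, \<nu>, \<mu>)))"

definition D_x ::
    "('a, 'n::finite) chart \<Rightarrow> 'n \<Rightarrow> ('a \<times> (real^'m) \<times> (real^'k) \<Rightarrow> real) \<Rightarrow>
     'a \<times> (real^'m) \<times> (real^'k) \<Rightarrow> real" where
  "D_x c j K = (\<lambda>(x, \<nu>, \<mu>). chart_partial c j (\<lambda>y. K (y, \<nu>, \<mu>)) x)"

definition D_nu ::
    "'m \<Rightarrow> ('a \<times> (real^'m) \<times> (real^'k) \<Rightarrow> real) \<Rightarrow>
     'a \<times> (real^'m) \<times> (real^'k) \<Rightarrow> real" where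
  "D_nu j K = (\<lambda>(x, \<nu>, \<mu>). partial_deriv j (\<lambda>y. K (x, y, \<mu>)) \<nu>)"

definition D_lambda ::
    "'k \<Rightarrow> ('a \<times> (real^'m) \<times> (real^'k) \<Rightarrow> real) \<Rightarrow>
     'a \<times> (real^'m) \<times> (real^'k) \<Rightarrow> real" where
  "D_lambda j K = (\<lambda>(x, \<nu>, \<mu>). partial_deriv j (\<lambda>y. K (x, \<nu>, y)) \<mu>)"

definition critical_set ::
    "'a set \<Rightarrow> ('a \<times> (real^'m) \<times> (real^'k) \<Rightarrow> real) \<Rightarrow> ('a \<times> (real^'m) \<times> (real^'k)) set" where
  "critical_set M K = {z. fst z \<in> M \<and> (\<forall>i. D_lambda i K z = 0)}"

text \<open>The rank conditions are imposed in every chart of the atlas around the point.\<close>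

definition morse_family ::
    "'a set \<Rightarrow> ('a, 'n::finite) chart set \<Rightarrow>
     ('a \<times> (real^'m) \<times> (real^'k) \<Rightarrow> real) \<Rightarrow> bool" where
  "morse_family M A K \<longleftrightarrow>
     smooth_family A K \<and>
     (\<forall>z\<in>critical_set M K. \<forall>c\<in>A. fst z \<in> fst c \<longrightarrow>
        rank (\<chi> (i::'k) (s::'n + 'm + 'k).
          case s of
            Inl j \<Rightarrow> D_lambda i (D_x c j K) z
          | Inr (Inl j) \<Rightarrow> D_lambda i (D_nu j K) z
          | Inr (Inr j) \<Rightarrow> D_lambda i (D_lambda j K) z) = CARD('k))"

definition restricted_morse_family ::
    "'a set \<Rightarrow> ('a, 'n::finite) chart set \<Rightarrow>
     ('a \<times> (real^'m) \<times> (real^'k) \<Rightarrow> real) \<Rightarrow> bool" where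
  "restricted_morse_family M A K \<longleftrightarrow>
     morse_family M A K \<and>
     (\<forall>z\<in>critical_set M K. \<forall>c\<in>A. fst z \<in> fst c \<longrightarrow>
        rank (\<chi> (i::'m) (s::'n + 'm).
          case s of
            Inl j \<Rightarrow> D_nu i (D_x c j K) z
          | Inr j \<Rightarrow> D_nu i (D_nu j K) z) = CARD('m))"


section \<open>Constrained Hamiltonian input-output systems\<close>

definition H_total ::
    "('a \<Rightarrow> real) \<Rightarrow> ('m::finite \<Rightarrow> 'a \<Rightarrow> real) \<Rightarrow> ('k::finite \<Rightarrow> 'a \<Rightarrow> real) \<Rightarrow>
     'a \<times> (real^'m) \<times> (real^'k) \<Rightarrow> real" where
  "H_total H G \<phi> = (\<lambda>(x, u, \<mu>).
     H x + (\<Sum>j\<in>UNIV. u $ j * G j x) + (\<Sum>i\<in>UNIV. \<mu> $ i * \<phi> i x))"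

text \<open>The matrix whose \<open>i\<close>-th row is the gradient of \<open>F i\<close> at \<open>x\<close> in the local coordinates of \<open>c\<close>.\<close>

definition jacobian_matrix ::
    "('a, 'n::finite) chart \<Rightarrow> ('r::finite \<Rightarrow> 'a \<Rightarrow> real) \<Rightarrow> 'a \<Rightarrow> real^'n^'r" where
  "jacobian_matrix c F x = (\<chi> i j. chart_partial c j (F i) x)"

definition zero_regular_value ::
    "'a set \<Rightarrow> ('a, 'n::finite) chart set \<Rightarrow> ('k::finite \<Rightarrow> 'a \<Rightarrow> real) \<Rightarrow> bool" where
  "zero_regular_value M A \<phi> \<longleftrightarrow>
     (\<forall>x\<in>M. (\<forall>i. \<phi> i x = 0) \<longrightarrow>
        (\<forall>c\<in>A. x \<in> fst c \<longrightarrow> rank (jacobian_matrix c \<phi> x) = CARD('k)))"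

definition no_input_redundancy ::
    "'a set \<Rightarrow> ('a, 'n::finite) chart set \<Rightarrow> ('m::finite \<Rightarrow> 'a \<Rightarrow> real) \<Rightarrow> bool" where
  "no_input_redundancy M A G \<longleftrightarrow>
     (\<forall>x\<in>M. \<forall>c\<in>A. x \<in> fst c \<longrightarrow> rank (jacobian_matrix c G x) = CARD('m))"

end

theory Submission
  imports Defs
begin

text \<open>
  In every chart \<open>\<partial>H\<^sub>T/\<partial>\<lambda>\<^sup>i = \<phi>\<^sub>i\<close>, so the critical set lies over the constraint set, and the leading
  blocks \<open>\<partial>\<^sup>2H\<^sub>T/\<partial>\<lambda>\<^sup>i\<partial>x\<^sup>j\<close> and \<open>\<partial>\<^sup>2H\<^sub>T/\<partial>u\<^sup>i\<partial>x\<^sup>j\<close> are the Jacobians of \<open>\<phi>\<close> and \<open>G\<close>. Each of these has full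
  row rank by hypothesis, which further columns cannot destroy. Smoothness of \<open>H\<^sub>T\<close> in a chart of
  \<open>T\<^sup>*Q\<close> needs the chart to have an open image, that is, every tuple of momenta must be realised by
  a covector.
\<close>

subsection \<open>Closure properties of \<open>C\<^sup>n\<close> functions\<close>

text \<open>Because \<open>S\<close> is open, functions that agree on \<open>S\<close> agree near
  each of its points and so have the same Frechet derivative there. The directional derivatives then
  agree on \<open>S\<close>, and induction applies to them.\<close>

lemma Ck_on_cong:
  assumes "open S" "\<And>x. x \<in> S \<Longrightarrow> f x = g x" "Ck_on n S f"
  shows "Ck_on n S g"
  using assms(2,3)
proof (induction n arbitrary: f g)
  case 0
  then show ?case
    using continuous_on_cong[OF refl, of S f g] by simp
next
  case (Suc n)
  have der: "(g has_derivative frechet_derivative f (at x)) (at x)" if "x \<in> S" for x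
  proof -
    have "(f has_derivative frechet_derivative f (at x)) (at x)"
      using Suc.prems(2) that by (simp add: frechet_derivative_works)
    then show ?thesis
      by (rule has_derivative_transform_within_open[OF _ assms(1) that]) (rule Suc.prems(1))
  qed
  show ?case
    unfolding Ck_on.simps
  proof (intro conjI ballI allI)
    fix v
    have "frechet_derivative f (at x) v = frechet_derivative g (at x) v" if "x \<in> S" for x
      using frechet_derivative_at[OF der[OF that]] by simp
    moreover have "Ck_on n S (\<lambda>x. frechet_derivative f (at x) v)"
      using Suc.prems(2) by simp
    ultimately show "Ck_on n S (\<lambda>x. frechet_derivative g (at x) v)"
      by (rule Suc.IH)
  qed (use der in \<open>blast intro: differentiableI\<close>)
qed

text \<open>Replaces the derivative selected by \<open>frechet_derivative\<close> with an explicit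
  formula \<open>D\<close>; the two coincide on \<open>S\<close> by uniqueness of the derivative.
  The closure proofs below enter the successor step through this rule.\<close>

lemma Ck_on_SucI:
  assumes "open S" "\<And>x. x \<in> S \<Longrightarrow> (f has_derivative D x) (at x)"
    and "\<And>v. Ck_on n S (\<lambda>x. D x v)"
  shows "Ck_on (Suc n) S f"
  unfolding Ck_on.simps
proof (intro conjI ballI allI)
  fix v
  have "D x v = frechet_derivative f (at x) v" if "x \<in> S" for x
    using frechet_derivative_at[OF assms(2)[OF that]] by simp
  then show "Ck_on n S (\<lambda>x. frechet_derivative f (at x) v)"
    using assms(3) by (rule Ck_on_cong[OF assms(1)])
qed (use assms(2) in \<open>blast intro: differentiableI\<close>)

lemma Ck_on_SucD:
  assumes "Ck_on (Suc n) S f"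
  shows "x \<in> S \<Longrightarrow> (f has_derivative frechet_derivative f (at x)) (at x)"
    and "Ck_on n S (\<lambda>x. frechet_derivative f (at x) v)"
  using assms by (auto simp: frechet_derivative_works)

lemma Ck_on_Suc_imp: "Ck_on (Suc n) S f \<Longrightarrow> Ck_on n S f"
proof (induction n arbitrary: f)
  case 0
  then show ?case
    by (auto intro!: continuous_at_imp_continuous_on differentiable_imp_continuous_within)
next
  case (Suc n)
  have "Ck_on n S (\<lambda>x. frechet_derivative f (at x) v)" for v
    using Suc.prems Ck_on.simps(2)[of "Suc n" S f] by (intro Suc.IH) blast
  then show ?case
    using Suc.prems by simp
qed

lemma Ck_on_subset: "Ck_on n S f \<Longrightarrow> T \<subseteq> S \<Longrightarrow> Ck_on n T f"
  by (induction n arbitrary: f) (auto intro: continuous_on_subset)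

lemma Ck_on_const: "open S \<Longrightarrow> Ck_on n S (\<lambda>x. c)"
proof (induction n arbitrary: c)
  case 0
  then show ?case by simp
next
  case (Suc n)
  show ?case
    by (rule Ck_on_SucI[where D="\<lambda>_ _. 0"]) (use Suc in auto)
qed

lemma Ck_on_bounded_linear:
  assumes "open S" "bounded_linear f"
  shows "Ck_on n S f"
proof (cases n)
  case 0
  then show ?thesis
    using assms(2) by (simp add: linear_continuous_on)
next
  case (Suc k)
  show ?thesis
    unfolding Suc
    by (rule Ck_on_SucI[where D="\<lambda>_. f"])
      (use assms in \<open>auto intro: bounded_linear_imp_has_derivative Ck_on_const\<close>)
qed

lemma Ck_on_add:
  assumes "open S"
  shows "Ck_on n S f \<Longrightarrow> Ck_on n S g \<Longrightarrow> Ck_on n S (\<lambda>x. f x + g x)"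
proof (induction n arbitrary: f g)
  case 0
  then show ?case by (auto intro: continuous_on_add)
next
  case (Suc n)
  show ?case
  proof (rule Ck_on_SucI[where D="\<lambda>x v. frechet_derivative f (at x) v + frechet_derivative g (at x) v"])
    show "((\<lambda>x. f x + g x) has_derivative
        (\<lambda>v. frechet_derivative f (at x) v + frechet_derivative g (at x) v)) (at x)" if "x \<in> S" for x
      using that Suc.prems by (intro has_derivative_add Ck_on_SucD(1))
    show "Ck_on n S (\<lambda>x. frechet_derivative f (at x) v + frechet_derivative g (at x) v)" for v
      using Suc.prems by (intro Suc.IH Ck_on_SucD(2))
  qed fact
qed

lemma Ck_on_mult:
  fixes f g :: "'a::real_normed_vector \<Rightarrow> real"
  assumes "open S"
  shows "Ck_on n S f \<Longrightarrow> Ck_on n S g \<Longrightarrow> Ck_on n S (\<lambda>x. f x * g x)"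
proof (induction n arbitrary: f g)
  case 0
  then show ?case by (auto intro: continuous_on_mult)
next
  case (Suc n)
  show ?case
  proof (rule Ck_on_SucI[where D="\<lambda>x v. f x * frechet_derivative g (at x) v
                                        + frechet_derivative f (at x) v * g x"])
    show "((\<lambda>x. f x * g x) has_derivative
        (\<lambda>v. f x * frechet_derivative g (at x) v + frechet_derivative f (at x) v * g x)) (at x)"
      if "x \<in> S" for x
      using that Suc.prems by (intro has_derivative_mult Ck_on_SucD(1))
    \<comment> \<open>The product rule leaves undifferentiated factors \<open>f\<close> and
      \<open>g\<close>, known to be of class \<open>Suc n\<close>; they are lowered to class
      \<open>n\<close> before the induction hypothesis is used.\<close>
    show "Ck_on n S (\<lambda>x. f x * frechet_derivative g (at x) v + frechet_derivative f (at x) v * g x)" for v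
      using Suc.prems by (intro Ck_on_add[OF assms] Suc.IH Ck_on_SucD(2)) (auto dest: Ck_on_Suc_imp simp del: Ck_on.simps)
  qed fact
qed

text \<open>For a fixed direction \<open>v\<close>, the derivative of \<open>f\<close> after
  \<open>fst\<close> is again a function of \<open>fst z\<close> alone, namely the derivative of
  \<open>f\<close> in direction \<open>fst v\<close>. The induction therefore closes without a chain
  rule of higher order.\<close>

lemma Ck_on_fst:
  assumes "open S"
  shows "Ck_on n S f \<Longrightarrow> Ck_on n (S \<times> UNIV) (\<lambda>z. f (fst z))"
proof (induction n arbitrary: f)
  case 0
  then show ?case
    by (auto intro!: continuous_on_compose2[of S f] continuous_intros)
next
  case (Suc n)
  show ?case
  proof (rule Ck_on_SucI[where D="\<lambda>z v. frechet_derivative f (at (fst z)) (fst v)"])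
    show "((\<lambda>z. f (fst z)) has_derivative (\<lambda>v. frechet_derivative f (at (fst z)) (fst v))) (at z)"
      if "z \<in> S \<times> UNIV" for z :: "'a \<times> 'c"
      using that Ck_on_SucD(1)[OF Suc.prems]
      by (intro has_derivative_compose[where f=fst and g=f, unfolded o_def])
        (auto intro: bounded_linear_imp_has_derivative bounded_linear_fst)
  qed (use assms Suc.IH Ck_on_SucD(2)[OF Suc.prems] in \<open>auto simp: open_Times\<close>)
qed

lemma Ck_on_bounded_linear_compose:
  assumes "open S" "bounded_linear L"
  shows "Ck_on n S f \<Longrightarrow> Ck_on n S (\<lambda>x. L (f x))"
proof (induction n arbitrary: f)
  case 0
  then show ?case
    using bounded_linear.continuous_on[OF assms(2)] by simp
next
  case (Suc n)
  show ?case
    by (rule Ck_on_SucI[where D="\<lambda>x v. L (frechet_derivative f (at x) v)"])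
      (use assms Suc Ck_on_SucD[OF Suc.prems] in
        \<open>auto intro: bounded_linear.has_derivative simp del: Ck_on.simps\<close>)
qed

lemma smooth_on_sum:
  assumes "open S" "\<And>i. i \<in> I \<Longrightarrow> smooth_on S (f i)"
  shows "smooth_on S (\<lambda>x. \<Sum>i\<in>I. f i x)"
  using assms(2)
  by (induction I rule: infinite_finite_induct)
    (auto simp: smooth_on_def Ck_on_const Ck_on_add assms(1))

lemma smooth_on_imp_differentiable:
  "smooth_on S f \<Longrightarrow> x \<in> S \<Longrightarrow> f differentiable (at x)"
  unfolding smooth_on_def using Ck_on.simps(2)[of 0 S f] by blast


subsection \<open>Partial derivatives\<close>

lemma DERIV_along_axis:
  fixes f :: "real^'n \<Rightarrow> real"
  assumes "(f has_derivative D) (at x)"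
  shows "((\<lambda>t. f (x + t *\<^sub>R axis j 1)) has_real_derivative D (axis j 1)) (at 0)"
proof -
  have "((\<lambda>t. x + t *\<^sub>R axis j 1) has_derivative (\<lambda>t. t *\<^sub>R axis j 1)) (at (0::real))"
    by (auto intro!: derivative_eq_intros)
  then have "((\<lambda>t. f (x + t *\<^sub>R axis j 1)) has_derivative (\<lambda>t. D (t *\<^sub>R axis j 1))) (at (0::real))"
    by (rule has_derivative_compose) (use assms in simp)
  moreover have "D (t *\<^sub>R axis j 1) = D (axis j 1) * t" for t
    using linear_scale[OF has_derivative_linear[OF assms]] by simp
  ultimately show ?thesis
    by (simp add: has_field_derivative_def)
qed

text \<open>Links the one-variable \<open>deriv\<close> behind \<open>partial_deriv\<close> to
  Frechet derivatives, so that sum and product rules become available for partial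
  derivatives.\<close>

lemma partial_deriv_eq:
  "(f has_derivative D) (at x) \<Longrightarrow> partial_deriv j f x = D (axis j 1)"
  unfolding partial_deriv_def by (intro DERIV_imp_deriv DERIV_along_axis)

text \<open>The total Hamiltonian and its x-derivatives are affine in the inputs and in the
  multipliers separately, so differentiating in either just reads off a coefficient.\<close>

lemma partial_deriv_affine: "partial_deriv i (\<lambda>y. a + (\<Sum>j\<in>UNIV. y $ j * b j)) x = b i"
proof -
  have "((\<lambda>y::real^'a. a + (\<Sum>j\<in>UNIV. y $ j * b j)) has_derivative
          (\<lambda>v. \<Sum>j\<in>UNIV. v $ j * b j)) (at x)"
    by (auto intro!: derivative_eq_intros bounded_linear_imp_has_derivative bounded_linear_vec_nth)
  then show ?thesis
    by (simp add: partial_deriv_eq axis_def if_distrib if_distribR cong: if_cong)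
qed


subsection \<open>Smooth functions on a manifold\<close>

text \<open>The last claim holds because a chart is an open map onto its image, and that image is
  itself open in the coordinate space.\<close>

lemma manifold_chart:
  assumes "smooth_manifold X A" "(U, \<psi>) \<in> A"
  shows "openin X U" "open (\<psi> ` U)" "inj_on \<psi> U"
    and "openin X W \<Longrightarrow> open (\<psi> ` (U \<inter> W))"
proof -
  show U: "openin X U" and o: "open (\<psi> ` U)"
    using assms unfolding smooth_manifold_def by auto
  have h: "homeomorphic_map (subtopology X U) (top_of_set (\<psi> ` U)) \<psi>"
    using assms unfolding smooth_manifold_def by auto
  have top: "topspace (subtopology X U) = U"
    using openin_subset[OF U] by auto
  show "inj_on \<psi> U"
    using homeomorphic_imp_injective_map[OF h] unfolding top .
  assume "openin X W"
  then have "openin (subtopology X U) (U \<inter> W)"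
    by (simp add: openin_subtopology_Int2)
  then have "openin (top_of_set (\<psi> ` U)) (\<psi> ` (U \<inter> W))"
    using homeomorphic_imp_open_map[OF h] unfolding open_map_def by blast
  then show "open (\<psi> ` (U \<inter> W))"
    using o openin_open_trans by blast
qed

lemma smooth_fun_on_subset:
  assumes "smooth_fun_on A W f" "W' \<subseteq> W"
  shows "smooth_fun_on A W' f"
  unfolding smooth_fun_on_def smooth_on_def
proof clarify
  fix U \<psi> n assume "(U, \<psi>) \<in> A"
  then have "Ck_on n (\<psi> ` (U \<inter> W)) (\<lambda>y. f (inv_into U \<psi> y))"
    using assms(1) unfolding smooth_fun_on_def smooth_on_def by blast
  then show "Ck_on n (\<psi> ` (U \<inter> W')) (\<lambda>y. f (inv_into U \<psi> y))"
    by (rule Ck_on_subset) (use assms(2) in blast)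
qed

text \<open>Both functions are smooth on the intersection of their neighbourhoods. Leaving the
  operation \<open>b\<close> abstract treats sums and products at once.\<close>

lemma smooth_near_binop:
  assumes "smooth_manifold X A" "smooth_near X A q f" "smooth_near X A q g"
    and "\<And>(S :: (real^'n::finite) set) f g. open S \<Longrightarrow> smooth_on S f \<Longrightarrow> smooth_on S g
           \<Longrightarrow> smooth_on S (\<lambda>y. b (f y) (g y))"
  shows "smooth_near X (A :: ('a, 'n) chart set) q (\<lambda>y. b (f y) (g y))"
proof -
  obtain W W' where W: "openin X W" "q \<in> W" "smooth_fun_on A W f"
    and W': "openin X W'" "q \<in> W'" "smooth_fun_on A W' g"
    using assms(2,3) unfolding smooth_near_def by blast
  have W2: "openin X (W \<inter> W')"
    using W(1) W'(1) by blast
  have "smooth_fun_on A (W \<inter> W') f" "smooth_fun_on A (W \<inter> W') g"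
    using smooth_fun_on_subset W(3) W'(3) by blast+
  then have "smooth_fun_on A (W \<inter> W') (\<lambda>y. b (f y) (g y))"
    unfolding smooth_fun_on_def
    using manifold_chart(4)[OF assms(1) _ W2] assms(4) by fast
  then show ?thesis
    unfolding smooth_near_def using W W' W2 by blast
qed

lemma smooth_near_add:
  assumes "smooth_manifold X A" "smooth_near X A q f" "smooth_near X A q g"
  shows "smooth_near X A q (\<lambda>y. f y + g y)"
  using assms by (rule smooth_near_binop) (simp add: smooth_on_def Ck_on_add)

lemma smooth_near_mult:
  assumes "smooth_manifold X A" "smooth_near X A q f" "smooth_near X A q g"
  shows "smooth_near X A q (\<lambda>y. f y * g y)"
  using assms by (rule smooth_near_binop) (simp add: smooth_on_def Ck_on_mult)

lemma smooth_near_const: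
  assumes "smooth_manifold X A" "q \<in> topspace X"
  shows "smooth_near X A q (\<lambda>y. c)"
  unfolding smooth_near_def smooth_fun_on_def smooth_on_def
  using assms manifold_chart(4)[OF assms(1) _ openin_topspace]
  by (intro exI[of _ "topspace X"]) (auto intro: Ck_on_const)

text \<open>Read in another chart, a coordinate function is a component of a transition map, which
  the atlas makes smooth.\<close>

lemma smooth_near_coordinate:
  assumes "smooth_manifold X A" "(U, \<psi>) \<in> A" "q \<in> U"
  shows "smooth_near X A q (\<lambda>y. \<psi> y $ j)"
  unfolding smooth_near_def
proof (intro exI conjI)
  show U: "openin X U"
    using manifold_chart(1) assms by blast
  show "smooth_fun_on A U (\<lambda>y. \<psi> y $ j)"
    unfolding smooth_fun_on_def
  proof clarify
    fix V \<eta> assume V: "(V, \<eta>) \<in> A"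
    then have "smooth_on (\<eta> ` (V \<inter> U)) (\<lambda>y. \<psi> (inv_into V \<eta> y))"
      using assms(1,2) unfolding smooth_manifold_def by blast
    then show "smooth_on (\<eta> ` (V \<inter> U)) (\<lambda>y. \<psi> (inv_into V \<eta> y) $ j)"
      unfolding smooth_on_def
      using Ck_on_bounded_linear_compose[OF manifold_chart(4)[OF assms(1) V U] bounded_linear_vec_nth]
      by blast
  qed
qed (use assms in auto)

lemma smooth_near_has_derivative:
  assumes "smooth_near X A q f" "(U, \<psi>) \<in> A" "q \<in> U"
  obtains D where "((\<lambda>y. f (inv_into U \<psi> y)) has_derivative D) (at (\<psi> q))"
proof -
  obtain W where W: "q \<in> W" "smooth_fun_on A W f"
    using assms(1) unfolding smooth_near_def by blast
  then have "smooth_on (\<psi> ` (U \<inter> W)) (\<lambda>y. f (inv_into U \<psi> y))"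
    using assms(2) unfolding smooth_fun_on_def by blast
  then have "(\<lambda>y. f (inv_into U \<psi> y)) differentiable (at (\<psi> q))"
    using smooth_on_imp_differentiable W(1) assms(3) by blast
  then show thesis
    using that unfolding differentiable_def by blast
qed


subsection \<open>Charts of the cotangent bundle\<close>

text \<open>Additivity and the Leibniz rule are the sum and product rules for derivatives of the
  chart expressions at \<open>\<psi> q\<close>. On functions not smooth near \<open>q\<close>, the
  value is 0 by definition.\<close>

lemma coord_vector_in_tangent_space:
  assumes X: "smooth_manifold X A" and c: "(U, \<psi>) \<in> A" "q \<in> U"
  shows "coord_vector X A (U, \<psi>) q i \<in> tangent_space X A q"
proof -
  have q: "q \<in> topspace X"
    using manifold_chart(1)[OF X c(1)] c(2) openin_subset by blast
  have inv: "inv_into U \<psi> (\<psi> q) = q"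
    using manifold_chart(3)[OF X c(1)] c(2) by (rule inv_into_f_f)
  let ?v = "coord_vector X A (U, \<psi>) q i"
  have sum: "?v (\<lambda>y. f y + g y) = ?v f + ?v g"
    and prod: "?v (\<lambda>y. f y * g y) = f q * ?v g + g q * ?v f"
    if fg: "smooth_near X A q f" "smooth_near X A q g" for f g
  proof -
    obtain D E where D: "((\<lambda>y. f (inv_into U \<psi> y)) has_derivative D) (at (\<psi> q))"
      and E: "((\<lambda>y. g (inv_into U \<psi> y)) has_derivative E) (at (\<psi> q))"
      using smooth_near_has_derivative fg c by metis
    show "?v (\<lambda>y. f y + g y) = ?v f + ?v g"
      using fg smooth_near_add[OF X fg]
      by (simp add: coord_vector_def partial_deriv_eq[OF has_derivative_add[OF D E]]
          partial_deriv_eq[OF D] partial_deriv_eq[OF E])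
    show "?v (\<lambda>y. f y * g y) = f q * ?v g + g q * ?v f"
      using fg smooth_near_mult[OF X fg]
      by (simp add: coord_vector_def partial_deriv_eq[OF has_derivative_mult[OF D E]]
          partial_deriv_eq[OF D] partial_deriv_eq[OF E] inv)
  qed
  \<comment> \<open>A derivation kills constants, so homogeneity is the Leibniz rule with one
    constant factor.\<close>
  have const: "?v (\<lambda>y. a) = 0" for a
    by (simp add: coord_vector_def partial_deriv_def)
  have "?v (\<lambda>y. a * f y) = a * ?v f" if "smooth_near X A q f" for a f
    using prod[OF smooth_near_const[OF X q] that] by (simp add: const)
  then show ?thesis
    unfolding tangent_space_def using sum prod by (auto simp: coord_vector_def)
qed

text \<open>In its own chart a coordinate function is a linear projection. This is true only on the
  image of \<open>U\<close>, but that image is open, so the derivative at \<open>\<psi> q\<close> is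
  the projection itself.\<close>

lemma coord_vector_coordinate:
  assumes X: "smooth_manifold X A" and c: "(U, \<psi>) \<in> A" "q \<in> U"
  shows "coord_vector X A (U, \<psi>) q i (\<lambda>y. \<psi> y $ j) = (if i = j then 1 else 0)"
proof -
  have "((\<lambda>y. \<psi> (inv_into U \<psi> y) $ j) has_derivative (\<lambda>v. v $ j)) (at (\<psi> q))"
  proof (rule has_derivative_transform_within_open)
    show "((\<lambda>y. y $ j) has_derivative (\<lambda>v. v $ j)) (at (\<psi> q))"
      by (rule bounded_linear_imp_has_derivative[OF bounded_linear_vec_nth])
    show "open (\<psi> ` U)"
      using manifold_chart(2) X c(1) by blast
  qed (use c in \<open>auto simp: f_inv_into_f\<close>)
  then show ?thesis
    using smooth_near_coordinate[OF X c]
    by (simp add: coord_vector_def partial_deriv_eq axis_def)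
qed

text \<open>On tangent vectors the witness is \<open>\<Sum>\<^sub>j p\<^sub>j dq\<^sup>j\<close>, where \<open>dq\<^sup>j v = v (q\<^sup>j)\<close>.\<close>

lemma ex_covector_with_components:
  assumes X: "smooth_manifold X A" and c: "(U, \<psi>) \<in> A" "q \<in> U"
  shows "\<exists>\<alpha>\<in>cotangent_space X A q. \<forall>i. \<alpha> (coord_vector X A (U, \<psi>) q i) = p i"
proof
  let ?T = "tangent_space X A q"
  let ?\<alpha> = "\<lambda>v. if v \<in> ?T then \<Sum>j\<in>UNIV. p j * v (\<lambda>y. \<psi> y $ j) else 0"
  show "\<forall>i. ?\<alpha> (coord_vector X A (U, \<psi>) q i) = p i"
    by (simp add: coord_vector_in_tangent_space[OF X c] coord_vector_coordinate[OF X c]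
        if_distrib cong: if_cong)
  \<comment> \<open>The witness is set to 0 off the tangent space, so its linearity requires that
    sums and multiples of tangent vectors remain in the tangent space.\<close>
  have add: "(\<lambda>f. v f + w f) \<in> ?T" if "v \<in> ?T" "w \<in> ?T" for v w
    using that unfolding tangent_space_def by (auto simp: algebra_simps)
  have scale: "(\<lambda>f. a * v f) \<in> ?T" if "v \<in> ?T" for v a
    using that unfolding tangent_space_def by (auto simp: algebra_simps)
  show "?\<alpha> \<in> cotangent_space X A q"
    unfolding cotangent_space_def
    by (auto simp: add scale algebra_simps sum.distrib sum_distrib_left)
qed

text \<open>The image is a cylinder: base coordinates in the image of \<open>U\<close>, momenta
  arbitrary. It is thus the preimage of an open set under the continuous projection to the
  \<open>Inl\<close> coordinates.\<close>

lemma open_cotangent_chart_image: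
  assumes X: "smooth_manifold X A" and c: "c \<in> cotangent_atlas X A"
  shows "open (snd c ` fst c)"
proof -
  obtain U \<psi> where U: "(U, \<psi>) \<in> A" and c_eq: "c = cotangent_chart X A (U, \<psi>)"
    using c unfolding cotangent_atlas_def by auto
  have "snd c ` fst c = (\<lambda>y. \<chi> i. y $ Inl i) -` (\<psi> ` U)"
  proof (intro subset_antisym subsetI)
    fix y assume "y \<in> snd c ` fst c"
    then show "y \<in> (\<lambda>y. \<chi> i. y $ Inl i) -` (\<psi> ` U)"
      unfolding c_eq cotangent_chart_def by (auto simp: vec_eq_iff)
  next
    fix y :: "real^('b + 'b)"
    assume "y \<in> (\<lambda>y. \<chi> i. y $ Inl i) -` (\<psi> ` U)"
    then obtain q where q: "q \<in> U" "(\<chi> i. y $ Inl i) = \<psi> q"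
      by auto
    \<comment> \<open>The base coordinates of \<open>y\<close> determine \<open>q\<close>; the
      covector is chosen to have the remaining coordinates of \<open>y\<close> as its
      momenta.\<close>
    obtain \<alpha> where \<alpha>: "\<alpha> \<in> cotangent_space X A q"
      "\<And>i. \<alpha> (coord_vector X A (U, \<psi>) q i) = y $ Inr i"
      using ex_covector_with_components[OF X U q(1), of "\<lambda>i. y $ Inr i"] by blast
    have "q \<in> topspace X"
      using manifold_chart(1)[OF X U] q(1) openin_subset by blast
    then have "(q, \<alpha>) \<in> fst c"
      using q(1) \<alpha>(1) unfolding c_eq cotangent_chart_def cotangent_bundle_def by auto
    moreover have "y = snd c (q, \<alpha>)"
      unfolding c_eq cotangent_chart_def
      using q(2) \<alpha>(2) by (auto simp: vec_eq_iff split: sum.split)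
    ultimately show "y \<in> snd c ` fst c"
      by blast
  qed
  moreover have "continuous_on UNIV (\<lambda>y::real^('b + 'b). \<chi> i. y $ Inl i)"
    by (intro continuous_intros)
  ultimately show ?thesis
    using manifold_chart(2)[OF X U] open_vimage by metis
qed


subsection \<open>The total Hamiltonian\<close>

text \<open>Full row rank means that the transpose is injective. A vector killed by the transpose of
  \<open>B\<close> is killed by the transpose of its left block \<open>M\<close>, hence is
  zero.\<close>

lemma rank_full_of_left_block:
  fixes M :: "real^'n^'r" and B :: "real^('n + 's::finite)^'r"
  assumes "rank M = CARD('r)" "\<And>i j. B $ i $ Inl j = M $ i $ j"
  shows "rank B = CARD('r)"
proof -
  have inj: "inj ((*v) (transpose M))"
    using assms(1) by (simp add: full_rank_injective[symmetric] rank_transpose)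
  have "w = 0" if "transpose B *v w = 0" for w
  proof -
    have "(transpose M *v w) $ j = (transpose B *v w) $ Inl j" for j
      by (simp add: matrix_vector_mult_def transpose_def assms(2))
    then have "transpose M *v w = transpose M *v 0"
      using that by (simp add: vec_eq_iff)
    then show "w = 0"
      using inj by (simp only: inj_eq)
  qed
  then have "inj ((*v) (transpose B))"
    by (simp add: linear_injective_0[OF matrix_vector_mul_linear])
  then show ?thesis
    by (simp add: full_rank_injective[symmetric] rank_transpose)
qed

section \<open>First and mixed second derivatives of the total Hamiltonian\<close>

lemma D_lambda_H_total: "D_lambda i (H_total H G \<phi>) (x, \<nu>, \<mu>) = \<phi> i x"
  unfolding D_lambda_def H_total_def by (simp add: partial_deriv_affine)

text \<open>Termwise differentiation in the chart. The formula holds for all \<open>\<nu>\<close>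
  and \<open>\<mu>\<close> at the fixed point \<open>x\<close> and is affine in each of them, so it
  can be differentiated once more in either.\<close>

lemma D_x_H_total:
  fixes H :: "'a \<Rightarrow> real"
  assumes "\<And>f. f \<in> insert H (range G \<union> range \<phi>) \<Longrightarrow>
      (\<lambda>y. f (inv_into U \<psi> y)) differentiable (at (\<psi> x))"
  shows "D_x (U, \<psi>) j (H_total H G \<phi>) (x, \<nu>, \<mu>) =
    chart_partial (U, \<psi>) j H x + (\<Sum>i\<in>UNIV. \<nu> $ i * chart_partial (U, \<psi>) j (G i) x) +
    (\<Sum>i\<in>UNIV. \<mu> $ i * chart_partial (U, \<psi>) j (\<phi> i) x)"
proof -
  define D where "D f = frechet_derivative (\<lambda>y. f (inv_into U \<psi> y)) (at (\<psi> x))" for f :: "'a \<Rightarrow> real"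
  have D: "((\<lambda>y. f (inv_into U \<psi> y)) has_derivative D f) (at (\<psi> x))"
    if "f \<in> insert H (range G \<union> range \<phi>)" for f
    unfolding D_def using assms[OF that] by (simp add: frechet_derivative_works)
  have "((\<lambda>y. H (inv_into U \<psi> y) + (\<Sum>i\<in>UNIV. \<nu> $ i * G i (inv_into U \<psi> y)) +
          (\<Sum>i\<in>UNIV. \<mu> $ i * \<phi> i (inv_into U \<psi> y))) has_derivative
        (\<lambda>v. D H v + (\<Sum>i\<in>UNIV. \<nu> $ i * D (G i) v) + (\<Sum>i\<in>UNIV. \<mu> $ i * D (\<phi> i) v))) (at (\<psi> x))"
    by (intro has_derivative_add has_derivative_sum has_derivative_mult_right D) auto
  then show ?thesis
    unfolding D_x_def H_total_def by (simp add: partial_deriv_eq partial_deriv_eq[OF D])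
qed

lemma D_lambda_D_x_H_total:
  assumes "\<And>f. f \<in> insert H (range G \<union> range \<phi>) \<Longrightarrow>
      (\<lambda>y. f (inv_into U \<psi> y)) differentiable (at (\<psi> x))"
  shows "D_lambda i (D_x (U, \<psi>) j (H_total H G \<phi>)) (x, \<nu>, \<mu>) = chart_partial (U, \<psi>) j (\<phi> i) x"
  unfolding D_lambda_def by (simp only: prod.case D_x_H_total[OF assms] partial_deriv_affine)

lemma D_nu_D_x_H_total:
  assumes "\<And>f. f \<in> insert H (range G \<union> range \<phi>) \<Longrightarrow>
      (\<lambda>y. f (inv_into U \<psi> y)) differentiable (at (\<psi> x))"
  shows "D_nu i (D_x (U, \<psi>) j (H_total H G \<phi>)) (x, \<nu>, \<mu>) = chart_partial (U, \<psi>) j (G i) x"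
proof -
  \<comment> \<open>The input sum stands between two terms constant in the inputs; these are merged
    into one to match the affine rule.\<close>
  have "partial_deriv i (\<lambda>y. a + (\<Sum>j\<in>UNIV. y $ j * b j) + c) \<nu> = b i" for a b c
    using partial_deriv_affine[of i "a + c" b \<nu>] by (simp add: ac_simps)
  then show ?thesis
    unfolding D_nu_def by (simp only: prod.case D_x_H_total[OF assms])
qed

text \<open>In a chart the family is a sum of products of functions of the base coordinates alone
  with coordinate projections of the inputs or multipliers; each factor is jointly smooth.\<close>

lemma smooth_family_H_total:
  fixes A :: "('a, 'n::finite) chart set"
    and G :: "'m::finite \<Rightarrow> 'a \<Rightarrow> real" and \<phi> :: "'k::finite \<Rightarrow> 'a \<Rightarrow> real"
  assumes "\<And>U \<psi>. (U, \<psi>) \<in> A \<Longrightarrow> open (\<psi> ` U)"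
    and "\<And>U \<psi> f. (U, \<psi>) \<in> A \<Longrightarrow> f \<in> insert H (range G \<union> range \<phi>) \<Longrightarrow>
      smooth_on (\<psi> ` U) (\<lambda>y. f (inv_into U \<psi> y))"
  shows "smooth_family A (H_total H G \<phi>)"
  unfolding smooth_family_def
proof clarify
  fix U \<psi> assume c: "(U, \<psi>) \<in> A"
  let ?S = "\<psi> ` U \<times> (UNIV :: ((real^'m) \<times> (real^'k)) set)"
  have S: "open ?S"
    using assms(1)[OF c] by (simp add: open_Times)
  have f: "smooth_on ?S (\<lambda>z. f (inv_into U \<psi> (fst z)))" if "f \<in> insert H (range G \<union> range \<phi>)" for f
    using Ck_on_fst[OF assms(1)[OF c]] assms(2)[OF c that] unfolding smooth_on_def by blast
  have \<nu>: "smooth_on ?S (\<lambda>z. fst (snd z) $ i)" for i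
    unfolding smooth_on_def
    by (intro allI Ck_on_bounded_linear[OF S] bounded_linear_vec_nth[THEN bounded_linear_compose]
        bounded_linear_fst_comp bounded_linear_snd)
  have \<mu>: "smooth_on ?S (\<lambda>z. snd (snd z) $ i)" for i
    unfolding smooth_on_def
    by (intro allI Ck_on_bounded_linear[OF S] bounded_linear_vec_nth[THEN bounded_linear_compose]
        bounded_linear_snd_comp bounded_linear_snd)
  have add: "smooth_on ?S (\<lambda>z. g z + h z)" and mult: "smooth_on ?S (\<lambda>z. g z * h z)"
    if "smooth_on ?S g" "smooth_on ?S h" for g h :: "_ \<Rightarrow> real"
    using that Ck_on_add[OF S] Ck_on_mult[OF S] unfolding smooth_on_def by blast+
  have "smooth_on ?S (\<lambda>z. H (inv_into U \<psi> (fst z))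
      + (\<Sum>j\<in>UNIV. fst (snd z) $ j * G j (inv_into U \<psi> (fst z)))
      + (\<Sum>i\<in>UNIV. snd (snd z) $ i * \<phi> i (inv_into U \<psi> (fst z))))"
    by (intro add smooth_on_sum[OF S] mult \<nu> \<mu> f) auto
  then show "smooth_on ?S (\<lambda>(y, \<nu>, \<mu>). H_total H G \<phi> (inv_into U \<psi> y, \<nu>, \<mu>))"
    by (simp add: H_total_def case_prod_beta')
qed

section \<open>Rank conditions at the critical points\<close>

theorem mainTheorem2:
  fixes Q :: "'q topology"
    and A :: "('q, 'd::finite) chart set"
    and H :: "'q covec \<Rightarrow> real"
    and G :: "'m::finite \<Rightarrow> 'q covec \<Rightarrow> real"
    and \<phi> :: "'k::finite \<Rightarrow> 'q covec \<Rightarrow> real"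
  assumes "smooth_manifold Q A"
    and "smooth_fun_on (cotangent_atlas Q A) (cotangent_bundle Q A) H"
    and "\<And>j. smooth_fun_on (cotangent_atlas Q A) (cotangent_bundle Q A) (G j)"
    and "\<And>i. smooth_fun_on (cotangent_atlas Q A) (cotangent_bundle Q A) (\<phi> i)"
    and "zero_regular_value (cotangent_bundle Q A) (cotangent_atlas Q A) \<phi>"
    and "no_input_redundancy (cotangent_bundle Q A) (cotangent_atlas Q A) G"
  shows "restricted_morse_family (cotangent_bundle Q A) (cotangent_atlas Q A) (H_total H G \<phi>)"
proof -
  let ?M = "cotangent_bundle Q A" and ?A = "cotangent_atlas Q A" and ?K = "H_total H G \<phi>"
  have smooth: "smooth_on (\<psi> ` U) (\<lambda>y. f (inv_into U \<psi> y))"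
    if "(U, \<psi>) \<in> ?A" "f \<in> insert H (range G \<union> range \<phi>)" for U \<psi> f
  proof -
    \<comment> \<open>\<open>smooth_fun_on\<close> speaks of the chart domain cut down to the
      bundle; as the domain lies in the bundle, this is the whole domain.\<close>
    have "U \<subseteq> ?M"
      using that(1) unfolding cotangent_atlas_def cotangent_chart_def by auto
    then have "U \<inter> ?M = U"
      by blast
    moreover have "smooth_fun_on ?A ?M f"
      using that(2) assms(2-4) by auto
    ultimately show ?thesis
      using that(1) unfolding smooth_fun_on_def by fastforce
  qed
  have diff: "(\<lambda>y. f (inv_into U \<psi> y)) differentiable (at (\<psi> x))"
    if "(U, \<psi>) \<in> ?A" "x \<in> U" "f \<in> insert H (range G \<union> range \<phi>)" for U \<psi> x f
    using smooth[OF that(1,3)] that(2) by (simp add: smooth_on_imp_differentiable)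
  have "open (\<psi> ` U)" if "(U, \<psi>) \<in> ?A" for U \<psi>
    using open_cotangent_chart_image[OF assms(1) that] by simp
  then have family: "smooth_family ?A ?K"
    using smooth by (rule smooth_family_H_total)
  \<comment> \<open>The derivative in the i-th multiplier is \<open>\<phi> i\<close>, so criticality
    is precisely the constraint equations over the bundle.\<close>
  have constraint: "\<phi> i (fst z) = 0" and base: "fst z \<in> ?M" if "z \<in> critical_set ?M ?K" for z i
    using that D_lambda_H_total[of i H G \<phi> "fst z" "fst (snd z)" "snd (snd z)"]
    unfolding critical_set_def by auto
  show ?thesis
    unfolding restricted_morse_family_def morse_family_def
  proof (intro conjI ballI impI family)
    fix z c assume z: "z \<in> critical_set ?M ?K" and c: "c \<in> ?A" "fst z \<in> fst c"
    obtain U \<psi> where U: "c = (U, \<psi>)" by force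
    obtain x \<nu> \<mu> where x: "z = (x, \<nu>, \<mu>)" by (metis prod.exhaust)
    have d: "(\<lambda>y. f (inv_into U \<psi> y)) differentiable (at (\<psi> x))"
      if "f \<in> insert H (range G \<union> range \<phi>)" for f
      using diff c that unfolding U x by simp
    have \<phi>_block: "D_lambda i (D_x c j ?K) z = jacobian_matrix c \<phi> x $ i $ j" for i j
      unfolding U x jacobian_matrix_def vec_lambda_beta using d by (rule D_lambda_D_x_H_total)
    have G_block: "D_nu i (D_x c j ?K) z = jacobian_matrix c G x $ i $ j" for i j
      unfolding U x jacobian_matrix_def vec_lambda_beta using d by (rule D_nu_D_x_H_total)
    \<comment> \<open>Regularity of the value 0 is available only on the constraint set, which is
      where critical points lie.\<close>
    have "rank (jacobian_matrix c \<phi> x) = CARD('k)"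
      using assms(5) base[OF z] constraint[OF z] c unfolding zero_regular_value_def x by simp
    then show "rank (\<chi> (i::'k) (s::('d + 'd) + 'm + 'k). case s of
          Inl j \<Rightarrow> D_lambda i (D_x c j ?K) z
        | Inr (Inl j) \<Rightarrow> D_lambda i (D_nu j ?K) z
        | Inr (Inr j) \<Rightarrow> D_lambda i (D_lambda j ?K) z) = CARD('k)"
      by (rule rank_full_of_left_block) (simp add: \<phi>_block)
    \<comment> \<open>The rank of the output Jacobian is assumed at every point of the bundle, in
      particular below this critical point.\<close>
    have "rank (jacobian_matrix c G x) = CARD('m)"
      using assms(6) base[OF z] c unfolding no_input_redundancy_def x by simp
    then show "rank (\<chi> (i::'m) (s::('d + 'd) + 'm). case s of
          Inl j \<Rightarrow> D_nu i (D_x c j ?K) z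
        | Inr j \<Rightarrow> D_nu i (D_nu j ?K) z) = CARD('m)"
      by (rule rank_full_of_left_block) (simp add: G_block)
  qed
qed

end
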